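(* Let $(\mathcal{M},\boldsymbol{g})$ be a four-dimensional, oriented and time-oriented space-time of signature $(+,-,-,-)$, let $\boldsymbol{F}\in\Omega^2(\mathcal{M})$ be a smooth, everywhere regular 2-form and let $\tilde{\boldsymbol{g}}=-\kappa_g^{-1}\left(\boldsymbol{F}^{2_g}+\frac{\psi_g}{2}\boldsymbol{g}\right)$. Let $\boldsymbol{X}$ be a vector field of wrench observers for $\boldsymbol{F}$ in $(\mathcal{M},\boldsymbol{g})$ with wrench 3-vector field $\boldsymbol{W}$, so that the electric and magnetic 3-vectors measured by $\boldsymbol{X}$ are $\boldsymbol{E}=\alpha\boldsymbol{W}$, $\boldsymbol{B}=\beta\boldsymbol{W}$ with real scalars $\alpha,\beta$. Put $\tilde{\boldsymbol{X}}=\boldsymbol{W}$, which satisfies $\tilde{\boldsymbol{g}}(\tilde{\boldsymbol{X}},\tilde{\boldsymbol{X}})=1$, and define $\tilde{\boldsymbol{E}},\tilde{\boldsymbol{B}}$ by $\tilde{\boldsymbol{E}}^{\flat_{\tilde g}}=-i_{\tilde{\boldsymbol{X}}}\boldsymbol{F}$ and $\tilde{\boldsymbol{B}}^{\flat_{\tilde g}}=i_{\tilde{\boldsymbol{X}}}\star_{\tilde g}\boldsymbol{F}$. Then $$\tilde{\boldsymbol{E}}^{\flat_{\tilde g}}=\alpha\boldsymbol{X}^{\flat_g},\qquad \tilde{\boldsymbol{B}}^{\flat_{\tilde g}}=\beta\boldsymbol{X}^{\flat_g},\qquad \tilde{\boldsymbol{E}}=-\alpha\boldsymbol{X},\qquad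 \tilde{\boldsymbol{B}}=-\beta\boldsymbol{X},$$ so that $\boldsymbol{W}$ is a wrench observer and $\tilde{\boldsymbol{W}}=-\boldsymbol{X}$ a wrench 3-vector for $\boldsymbol{F}$ in $(\mathcal{M},\tilde{\boldsymbol{g}})$. Moreover $$\tilde{\boldsymbol{g}}(\tilde{\boldsymbol{E}},\tilde{\boldsymbol{E}})=\boldsymbol{g}(\boldsymbol{E},\boldsymbol{E})=-\alpha^2,\quad \tilde{\boldsymbol{g}}(\tilde{\boldsymbol{B}},\tilde{\boldsymbol{B}})=\boldsymbol{g}(\boldsymbol{B},\boldsymbol{B})=-\beta^2,\quad \tilde{\boldsymbol{g}}(\tilde{\boldsymbol{E}},\tilde{\boldsymbol{B}})=\boldsymbol{g}(\boldsymbol{E},\boldsymbol{B})=-\alpha\beta.$$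
   Context: Conventions. For a Lorentzian metric $\boldsymbol{h}$ of signature $(+,-,-,-)$ on the oriented 4-manifold $\mathcal{M}$, with $h=\det(h_{ab})$ in positively oriented coordinates and $[abcd]$ the Levi-Civita permutation symbol with $[0123]=1$, the Hodge dual of a 2-form $\boldsymbol{G}$ is $\star_{h}G_{ab}=\frac12\sqrt{-h}\,[abcd](h^{-1})^{cp}(h^{-1})^{dq}G_{pq}$ (the same orientation is used for all metrics), and the inner product of 2-forms is $\langle\boldsymbol{G},\boldsymbol{H}\rangle_h=\frac12(h^{-1})^{ac}(h^{-1})^{bd}G_{ab}H_{cd}$. Also $(\boldsymbol{F}^{2_h})_{ab}=F_{ac}(h^{-1})^{cd}F_{db}$. Invariants of $\boldsymbol{F}$: $\psi_h=\langle\boldsymbol{F},\boldsymbol{F}\rangle_h$, $\phi_h=\langle\boldsymbol{F},\star_h\boldsymbol{F}\rangle_h$, $\kappa_h=\frac12\sqrt{\psi_h^2+\phi_h^2}$. $\boldsymbol{F}$ is regular if $\kappa_g\neq0$; then $\tilde{\boldsymbol{g}}$ is a Lorentzian metric of signature $(+,-,-,-)$. For a vector $\boldsymbol{V}$, $\boldsymbol{V}^{\flat_h}=\boldsymbol{h}(\cdot,\boldsymbol{V})$ and $(i_{\boldsymbol{V}}\boldsymbol{F})_a=V^bF_{ba}$. An observer in $(\mathcal{M},\boldsymbol{h})$ is a (future-directed) vector $\boldsymbol{X}$ with $\boldsymbol{h}(\boldsymbol{X},\boldsymbol{X})=1$; the electric and magnetic 3-vectors $\boldsymbol{E},\boldsymbol{B}\in\boldsymbol{X}^{\perp_h}$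 it measures are defined by $\boldsymbol{E}^{\flat_h}=-i_{\boldsymbol{X}}\boldsymbol{F}$, $\boldsymbol{B}^{\flat_h}=i_{\boldsymbol{X}}\star_h\boldsymbol{F}$. $\boldsymbol{X}$ is a wrench observer, with wrench 3-vector $\boldsymbol{W}$, if $\boldsymbol{W}\in\boldsymbol{X}^{\perp_h}$, $\boldsymbol{h}(\boldsymbol{W},\boldsymbol{W})=-1$ and $\boldsymbol{E}=\alpha\boldsymbol{W}$, $\boldsymbol{B}=\beta\boldsymbol{W}$ for real scalars $\alpha,\beta$. The future in $(\mathcal{M},\tilde{\boldsymbol{g}})$ is chosen, by convention, to be given by the direction of $\boldsymbol{W}$. (The paper fixes the sign of $\boldsymbol{W}$ by requiring $\alpha>0$ if $\psi_g\le0$ and $\beta>0$ if $\psi_g>0$; the identities do not depend on this choice.) *)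

theory Defs
  imports "HOL-Analysis.Analysis" "HOL-Combinatorics.Permutations"
begin

section \<open>Oriented smooth 4-manifolds\<close>

text \<open>The index type \<^typ>\<open>4\<close> has the elements 0, 1, 2, 3 (and 4 = 0), so indices are
  written as in \<open>[0123]\<close>. Vectors and covectors are elements of \<^typ>\<open>real^4\<close>; a covariant 2-tensor
  \<open>T\<^sub>a\<^sub>b\<close> is the matrix with entries \<open>T $ a $ b\<close>.\<close>

primrec Ck_on :: "nat \<Rightarrow> ('a::euclidean_space \<Rightarrow> 'b::real_normed_vector) \<Rightarrow> 'a set \<Rightarrow> bool" where
  "Ck_on 0 f S \<longleftrightarrow> continuous_on S f"
| "Ck_on (Suc k) f S \<longleftrightarrow>
     (\<forall>x\<in>S. f differentiable (at x)) \<and>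
     (\<forall>v. Ck_on k (\<lambda>x. frechet_derivative f (at x) v) S)"

text \<open>Only used for open \<open>S\<close>.\<close>

definition smooth_on :: "('a::euclidean_space \<Rightarrow> 'b::real_normed_vector) \<Rightarrow> 'a set \<Rightarrow> bool" where
  "smooth_on f S \<longleftrightarrow> (\<forall>k. Ck_on k f S)"

type_synonym 'm chart = "'m set \<times> ('m \<Rightarrow> real^4)"

abbreviation dom_chart :: "'m chart \<Rightarrow> 'm set" where
  "dom_chart c \<equiv> fst c"

definition chart_inv :: "'m chart \<Rightarrow> real^4 \<Rightarrow> 'm" where
  "chart_inv c = inv_into (fst c) (snd c)"

definition is_chart :: "('m::topological_space) chart \<Rightarrow> bool" where
  "is_chart c \<longleftrightarrow> open (dom_chart c) \<and> open (snd c ` dom_chart c) \<and>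
     homeomorphism (dom_chart c) (snd c ` dom_chart c) (snd c) (chart_inv c)"

text \<open>The transition map from the coordinates of \<open>c\<close> to those of \<open>c'\<close>, and its Jacobian matrix
  \<open>\<partial>x'\<^sup>a/\<partial>x\<^sup>b\<close> at \<open>p\<close>.\<close>

definition transition :: "'m chart \<Rightarrow> 'm chart \<Rightarrow> real^4 \<Rightarrow> real^4" where
  "transition c c' = snd c' \<circ> chart_inv c"

definition jacobian_at :: "'m chart \<Rightarrow> 'm chart \<Rightarrow> 'm \<Rightarrow> real^4^4" where
  "jacobian_at c c' p = matrix (frechet_derivative (transition c c') (at (snd c p)))"

definition oriented_atlas :: "('m::topological_space) chart set \<Rightarrow> bool" where
  "oriented_atlas \<A> \<longleftrightarrow>
     (\<forall>c\<in>\<A>. is_chart c) \<and> (\<Union>c\<in>\<A>. dom_chart c) = UNIV \<and>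
     (\<forall>c\<in>\<A>. \<forall>c'\<in>\<A>.
        smooth_on (transition c c') (snd c ` (dom_chart c \<inter> dom_chart c')) \<and>
        (\<forall>p\<in>dom_chart c \<inter> dom_chart c'. det (jacobian_at c c' p) > 0))"

section \<open>Tensor fields\<close>

text \<open>A tensor field is given by its components in every chart of the atlas, subject to the
  tensorial transformation law. Values outside the domain of the chart, or for charts outside the
  atlas, carry no information.\<close>

definition vector_field :: "'m chart set \<Rightarrow> ('m chart \<Rightarrow> 'm \<Rightarrow> real^4) \<Rightarrow> bool" where
  "vector_field \<A> V \<longleftrightarrow>
     (\<forall>c\<in>\<A>. \<forall>c'\<in>\<A>. \<forall>p\<in>dom_chart c \<inter> dom_chart c'. V c' p = jacobian_at c c' p *v V c p)"

definition covariant2_field :: "'m chart set \<Rightarrow> ('m chart \<Rightarrow> 'm \<Rightarrow> real^4^4) \<Rightarrow> bool" where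
  "covariant2_field \<A> T \<longleftrightarrow>
     (\<forall>c\<in>\<A>. \<forall>c'\<in>\<A>. \<forall>p\<in>dom_chart c \<inter> dom_chart c'.
        T c p = transpose (jacobian_at c c' p) ** T c' p ** jacobian_at c c' p)"

definition smooth_field ::
    "'m chart set \<Rightarrow> ('m chart \<Rightarrow> 'm \<Rightarrow> 'b::real_normed_vector) \<Rightarrow> bool" where
  "smooth_field \<A> T \<longleftrightarrow>
     (\<forall>c\<in>\<A>. smooth_on (\<lambda>x. T c (chart_inv c x)) (snd c ` dom_chart c))"

definition smooth_2form :: "'m chart set \<Rightarrow> ('m chart \<Rightarrow> 'm \<Rightarrow> real^4^4) \<Rightarrow> bool" where
  "smooth_2form \<A> F \<longleftrightarrow> covariant2_field \<A> F \<and> smooth_field \<A> F \<and>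
     (\<forall>c\<in>\<A>. \<forall>p\<in>dom_chart c. transpose (F c p) = - F c p)"

section \<open>Lorentzian metrics\<close>

definition minkowski :: "real^4^4" where
  "minkowski = (\<chi> a b. if a = b then (if a = 0 then 1 else - 1) else 0)"

text \<open>Signature \<open>(+,-,-,-)\<close>: the columns of \<open>P\<close> form an orthonormal basis.\<close>

definition lorentzian_form :: "real^4^4 \<Rightarrow> bool" where
  "lorentzian_form h \<longleftrightarrow>
     transpose h = h \<and> (\<exists>P. invertible P \<and> transpose P ** h ** P = minkowski)"

definition lorentzian_metric :: "'m chart set \<Rightarrow> ('m chart \<Rightarrow> 'm \<Rightarrow> real^4^4) \<Rightarrow> bool" where
  "lorentzian_metric \<A> g \<longleftrightarrow> covariant2_field \<A> g \<and> smooth_field \<A> g \<and>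
     (\<forall>c\<in>\<A>. \<forall>p\<in>dom_chart c. lorentzian_form (g c p))"

definition metric_prod :: "real^4^4 \<Rightarrow> real^4 \<Rightarrow> real^4 \<Rightarrow> real" where
  "metric_prod h U V = (\<Sum>a\<in>UNIV. \<Sum>b\<in>UNIV. h $ a $ b * U $ a * V $ b)"

text \<open>A time orientation is represented by a timelike vector field \<open>T\<close> pointing to the future.\<close>

definition time_orientation ::
    "'m chart set \<Rightarrow> ('m chart \<Rightarrow> 'm \<Rightarrow> real^4^4) \<Rightarrow> ('m chart \<Rightarrow> 'm \<Rightarrow> real^4) \<Rightarrow> bool" where
  "time_orientation \<A> g T \<longleftrightarrow> vector_field \<A> T \<and> smooth_field \<A> T \<and>
     (\<forall>c\<in>\<A>. \<forall>p\<in>dom_chart c. metric_prod (g c p) (T c p) (T c p) > 0)"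

definition flat :: "real^4^4 \<Rightarrow> real^4 \<Rightarrow> real^4" where
  "flat h V = (\<chi> a. \<Sum>b\<in>UNIV. h $ a $ b * V $ b)"

definition contract :: "real^4 \<Rightarrow> real^4^4 \<Rightarrow> real^4" where
  "contract V F = (\<chi> a. \<Sum>b\<in>UNIV. V $ b * F $ b $ a)"

definition perm_symbol :: "4 \<Rightarrow> 4 \<Rightarrow> 4 \<Rightarrow> 4 \<Rightarrow> real" where
  "perm_symbol a b c d =
     (if distinct [a, b, c, d]
      then of_int (sign (\<lambda>i::4. if i = 0 then a else if i = 1 then b else if i = 2 then c else d))
      else 0)"

text \<open>The indices of the following definition refer to a positively oriented chart.\<close>

definition hodge :: "real^4^4 \<Rightarrow> real^4^4 \<Rightarrow> real^4^4" where
  "hodge h G = (\<chi> a b. 1 / 2 * sqrt (- det h) *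
     (\<Sum>c\<in>UNIV. \<Sum>d\<in>UNIV. \<Sum>p\<in>UNIV. \<Sum>q\<in>UNIV.
        perm_symbol a b c d * matrix_inv h $ c $ p * matrix_inv h $ d $ q * G $ p $ q))"

definition form_inner :: "real^4^4 \<Rightarrow> real^4^4 \<Rightarrow> real^4^4 \<Rightarrow> real" where
  "form_inner h G H = 1 / 2 *
     (\<Sum>a\<in>UNIV. \<Sum>b\<in>UNIV. \<Sum>c\<in>UNIV. \<Sum>d\<in>UNIV.
        matrix_inv h $ a $ c * matrix_inv h $ b $ d * G $ a $ b * H $ c $ d)"

definition form_square :: "real^4^4 \<Rightarrow> real^4^4 \<Rightarrow> real^4^4" where
  "form_square h F = F ** matrix_inv h ** F"

definition psi :: "real^4^4 \<Rightarrow> real^4^4 \<Rightarrow> real" where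
  "psi h F = form_inner h F F"

definition phi :: "real^4^4 \<Rightarrow> real^4^4 \<Rightarrow> real" where
  "phi h F = form_inner h F (hodge h F)"

definition kappa :: "real^4^4 \<Rightarrow> real^4^4 \<Rightarrow> real" where
  "kappa h F = 1 / 2 * sqrt ((psi h F)\<^sup>2 + (phi h F)\<^sup>2)"

definition regular_form :: "real^4^4 \<Rightarrow> real^4^4 \<Rightarrow> bool" where
  "regular_form h F \<longleftrightarrow> kappa h F \<noteq> 0"

definition tilde_metric :: "real^4^4 \<Rightarrow> real^4^4 \<Rightarrow> real^4^4" where
  "tilde_metric g F = - inverse (kappa g F) *\<^sub>R (form_square g F + (psi g F / 2) *\<^sub>R g)"

section \<open>Observers\<close>

text \<open>The following notions live in a single tangent space with Lorentzian form \<open>h\<close>. The electric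
  and magnetic vectors are well defined since \<open>flat h\<close> is then bijective.\<close>

definition electric :: "real^4^4 \<Rightarrow> real^4^4 \<Rightarrow> real^4 \<Rightarrow> real^4" where
  "electric h F X = (THE E. flat h E = - contract X F)"

definition magnetic :: "real^4^4 \<Rightarrow> real^4^4 \<Rightarrow> real^4 \<Rightarrow> real^4" where
  "magnetic h F X = (THE B. flat h B = contract X (hodge h F))"

text \<open>\<open>T\<close> is a timelike vector giving the future direction: a timelike \<open>X\<close> lies in the same cone
  as \<open>T\<close> iff \<open>h(T, X) > 0\<close>.\<close>

definition observer :: "real^4^4 \<Rightarrow> real^4 \<Rightarrow> real^4 \<Rightarrow> bool" where
  "observer h T X \<longleftrightarrow> metric_prod h X X = 1 \<and> metric_prod h T X > 0"

definition wrench_observer ::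
    "real^4^4 \<Rightarrow> real^4 \<Rightarrow> real^4^4 \<Rightarrow> real^4 \<Rightarrow> real^4 \<Rightarrow> bool" where
  "wrench_observer h T F X W \<longleftrightarrow> observer h T X \<and>
     metric_prod h X W = 0 \<and> metric_prod h W W = - 1 \<and>
     (\<exists>\<alpha> \<beta>. electric h F X = \<alpha> *\<^sub>R W \<and> magnetic h F X = \<beta> *\<^sub>R W)"

end

theory Submission
  imports Defs
begin

text \<open>The claim is pointwise linear algebra. Complete \<open>X, W\<close> to a positively oriented
  \<open>g\<close>-orthonormal frame. There \<open>F\<close> has only the components \<open>F\<^sub>0\<^sub>1 = \<alpha>\<close> and \<open>F\<^sub>2\<^sub>3 = - \<beta>\<close>, whence
  \<open>\<kappa> = (\<alpha>\<^sup>2 + \<beta>\<^sup>2) / 2\<close>, and the second metric is \<open>diag(-1, 1, -1, -1)\<close>: the roles of \<open>X\<close> and \<open>W\<close> are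
  exchanged. All constructions commute with the change of frame; for the Hodge dual this rests on
  the contraction of the permutation symbol with four copies of a matrix being its determinant.\<close>

section \<open>Index sums over 0, 1, 2, 3 and inverses of matrices\<close>

lemma UNIV_4_zero: "(UNIV :: 4 set) = {0, 1, 2, 3}"
proof -
  \<comment> \<open>\<open>UNIV_4\<close> lists the indices as 1, 2, 3, 4. Modulo 4 the last one is
    the time index 0.\<close>
  have "(4::4) = 0" by simp
  with UNIV_4 show ?thesis by (simp add: insert_commute)
qed

lemma sum_4_zero: "sum f (UNIV :: 4 set) = f 0 + f 1 + f 2 + f 3"
  unfolding UNIV_4_zero by (simp add: add.assoc)

lemma forall_4_zero: "(\<forall>i::4. P i) \<longleftrightarrow> P 0 \<and> P 1 \<and> P 2 \<and> P 3"
proof -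
  have "(\<forall>i::4. P i) \<longleftrightarrow> (\<forall>i\<in>UNIV. P i)" by simp
  then show ?thesis by (simp only: UNIV_4_zero) simp
qed

lemma invertible_matrix_inv:
  fixes A :: "real^'n^'n"
  assumes "invertible A"
  shows matrix_inv_right: "A ** matrix_inv A = mat 1"
    and matrix_inv_left: "matrix_inv A ** A = mat 1"
proof -
  have "\<exists>B. A ** B = mat 1 \<and> B ** A = mat 1"
    using assms by (simp add: invertible_def)
  from someI_ex[OF this] show "A ** matrix_inv A = mat 1" "matrix_inv A ** A = mat 1"
    by (simp_all add: matrix_inv_def)
qed

text \<open>For square matrices a right inverse is two-sided, so a single product has to be
  checked.\<close>

lemma matrix_inv_eqI:
  fixes A :: "real^'n^'n"
  assumes "A ** B = mat 1"
  shows "matrix_inv A = B"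
proof -
  have "invertible A"
    using assms invertible_right_inverse by blast
  then have "matrix_inv A ** A = mat 1"
    by (rule matrix_inv_left)
  have "matrix_inv A = matrix_inv A ** (A ** B)"
    by (simp add: assms)
  also have "\<dots> = matrix_inv A ** A ** B"
    by (rule matrix_mul_assoc)
  also have "\<dots> = B"
    by (simp only: \<open>matrix_inv A ** A = mat 1\<close> matrix_mul_lid)
  finally show ?thesis .
qed

subsection \<open>The permutation symbol as a determinant\<close>

text \<open>Lists four values as a function of the index. It serves for index tuples, for the rows
  of a matrix and for the signs on a diagonal alike.\<close>

definition quad :: "'a \<Rightarrow> 'a \<Rightarrow> 'a \<Rightarrow> 'a \<Rightarrow> 4 \<Rightarrow> 'a" where
  "quad a b c d i = (if i = 0 then a else if i = 1 then b else if i = 2 then c else d)"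

lemma quad_simps [simp]:
  "quad a b c d 0 = a" "quad a b c d 1 = b" "quad a b c d 2 = c" "quad a b c d 3 = d"
  by (simp_all add: quad_def)

lemma quad_eta: "quad (f 0) (f 1) (f 2) (f 3) = f"
  unfolding fun_eq_iff by (subst forall_4_zero) simp

text \<open>Permuting the rows of the identity matrix produces the sign, and a repeated index
  produces two equal rows. The symbol thereby inherits the alternation and multiplicativity of
  \<open>det\<close>.\<close>

lemma perm_symbol_eq_det: "perm_symbol a b c d = det (\<chi> i. axis (quad a b c d i) 1)"
proof -
  have inj_iff: "(\<forall>i j. quad a b c d i = quad a b c d j \<longrightarrow> i = j) \<longleftrightarrow> distinct [a, b, c, d]"
    unfolding forall_4_zero by auto
  show ?thesis
  proof (cases "distinct [a, b, c, d]")
    case True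
    then have "inj (quad a b c d)"
      using inj_iff by (simp add: inj_def)
    then have "quad a b c d permutes UNIV"
      by (intro bij_imp_permutes) (auto simp: bij_betw_def dest: finite_UNIV_inj_surj[OF finite])
    then have "det (\<chi> i. (mat 1 :: real^4^4) $ quad a b c d i) = of_int (sign (quad a b c d))"
      by (subst det_permute_rows) auto
    moreover have "(mat 1 :: real^4^4) $ k = axis k 1" for k
      by (simp add: mat_def axis_def vec_eq_iff)
    ultimately show ?thesis
      using True by (simp add: perm_symbol_def quad_def [abs_def])
  next
    case False
    then obtain i j where "i \<noteq> j" "quad a b c d i = quad a b c d j"
      using inj_iff by blast
    then have "det (\<chi> i. (axis (quad a b c d i) 1 :: real^4)) = 0"
      by (intro det_identical_rows[of i j]) (simp_all only: row_def vec_lambda_beta not_False_eq_True)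
    then show ?thesis
      using False by (simp only: perm_symbol_def if_False)
  qed
qed

lemma perm_symbol_swap:
  shows "perm_symbol b a c d = - perm_symbol a b c d"
    and "perm_symbol a c b d = - perm_symbol a b c d"
    and "perm_symbol a b d c = - perm_symbol a b c d"
proof -
  have swap: "det (\<chi> i. (axis (f (Transposition.transpose m n i)) 1 :: real^4))
      = - det (\<chi> i. (axis (f i) 1 :: real^4))" if "m \<noteq> n" for m n :: 4 and f
    using det_permute_rows[of "Transposition.transpose m n" "\<chi> i. (axis (f i) 1 :: real^4)"] that
    by (simp add: permutes_swap_id sign_swap_id)
  have "quad b a c d = (\<lambda>i. quad a b c d (Transposition.transpose 0 1 i))"
    "quad a c b d = (\<lambda>i. quad a b c d (Transposition.transpose 1 2 i))"
    "quad a b d c = (\<lambda>i. quad a b c d (Transposition.transpose 2 3 i))"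
    by (simp_all add: fun_eq_iff forall_4_zero Transposition.transpose_def)
  with swap[of 0 1 "quad a b c d"] swap[of 1 2 "quad a b c d"] swap[of 2 3 "quad a b c d"]
  show "perm_symbol b a c d = - perm_symbol a b c d"
    "perm_symbol a c b d = - perm_symbol a b c d"
    "perm_symbol a b d c = - perm_symbol a b c d"
    by (simp_all add: perm_symbol_eq_det)
qed

lemma perm_symbol_0123: "perm_symbol 0 1 2 3 = 1"
proof -
  have "(\<chi> i. axis (quad 0 1 2 3 i) 1) = (mat 1 :: real^4^4)"
    using quad_eta[of id] by (simp add: mat_def axis_def vec_eq_iff)
  then show ?thesis
    by (simp add: perm_symbol_eq_det)
qed

text \<open>A function on four indices is a quadruple. This turns the sum over all row selections in
  a multilinear expansion into a fourfold index sum.\<close>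

lemma sum_quad:
  "(\<Sum>f\<in>UNIV. \<Phi> f) = (\<Sum>a\<in>UNIV. \<Sum>b\<in>UNIV. \<Sum>c\<in>UNIV. \<Sum>d\<in>UNIV. \<Phi> (quad a b c d))"
  for \<Phi> :: "(4 \<Rightarrow> 'a::finite) \<Rightarrow> 'b::comm_monoid_add"
proof -
  have "(\<Sum>f\<in>UNIV. \<Phi> f) = (\<Sum>(a, b, c, d)\<in>UNIV. \<Phi> (quad a b c d))"
    by (rule sum.reindex_bij_witness[where j = "\<lambda>f. (f 0, f 1, f 2, f 3)"
          and i = "\<lambda>(a, b, c, d). quad a b c d"]) (auto simp: quad_eta)
  also have "\<dots> = (\<Sum>(a, b, c, d)\<in>UNIV \<times> UNIV \<times> UNIV \<times> UNIV. \<Phi> (quad a b c d))"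
    by simp
  finally show ?thesis
    by (simp only: sum.cartesian_product' split_def fst_conv snd_conv)
qed

lemma det_eq_sum_perm_symbol:
  "(\<Sum>a\<in>UNIV. \<Sum>b\<in>UNIV. \<Sum>c\<in>UNIV. \<Sum>d\<in>UNIV. perm_symbol a b c d * (t $ a * u $ b * v $ c * w $ d))
    = det (\<chi> i. quad t u v w i)"
proof -
  let ?q = "quad t u v w"
  have prod: "(\<Prod>i\<in>UNIV. ?q i $ f i) = t $ f 0 * u $ f 1 * v $ f 2 * w $ f 3" for f
    unfolding UNIV_4_zero by simp
  \<comment> \<open>Each row is expanded in the standard basis. Multilinearity then gives one term
    per choice \<open>f\<close> of a basis vector in every row; the choices that are not injective
    vanish through the symbol.\<close>
  have "(\<chi> i. ?q i) = (\<chi> i. \<Sum>j\<in>UNIV. ?q i $ j *s axis j 1)"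
    by (simp add: basis_expansion)
  then have "det (\<chi> i. ?q i) = (\<Sum>f\<in>UNIV. det (\<chi> i. ?q i $ f i *s axis (f i) 1))"
    using det_linear_rows_sum[of UNIV "\<lambda>i j. ?q i $ j *s axis j 1"] by simp
  also have "\<dots> = (\<Sum>f\<in>UNIV. (\<Prod>i\<in>UNIV. ?q i $ f i) * det (\<chi> i. axis (f i) 1))"
    by (simp add: det_rows_mul)
  finally show ?thesis
    by (simp only: sum_quad prod perm_symbol_eq_det quad_simps mult.commute)
qed

text \<open>The chosen columns of \<open>P\<close>, written as rows, form a row selection of the
  identity times \<open>transpose P\<close>; the determinant of this product factors. This is what
  makes the Hodge dual natural.\<close>

lemma perm_symbol_contract:
  "(\<Sum>a\<in>UNIV. \<Sum>b\<in>UNIV. \<Sum>c\<in>UNIV. \<Sum>d\<in>UNIV.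
      perm_symbol a b c d * (P $ a $ i * P $ b $ j * P $ c $ k * P $ d $ l))
    = det P * perm_symbol i j k l"
proof -
  have "(\<chi> m. quad (column i P) (column j P) (column k P) (column l P) m)
      = (\<chi> m. axis (quad i j k l m) 1) ** transpose P"
    by (simp add: vec_eq_iff forall_4_zero matrix_matrix_mult_def transpose_def axis_def column_def
        if_distrib[of "\<lambda>x. x * _"] cong: if_cong)
  then show ?thesis
    using det_eq_sum_perm_symbol[of "column i P" "column j P" "column k P" "column l P"]
    by (simp add: column_def det_mul perm_symbol_eq_det mult.commute)
qed

subsection \<open>Naturality under pullback\<close>

text \<open>The components of the bilinear form \<open>M\<close> in the frame whose vectors are the
  columns of \<open>P\<close>.\<close>

definition pullback_form :: "real^'n^'n \<Rightarrow> real^'n^'n \<Rightarrow> real^'n^'n" where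
  "pullback_form P M = transpose P ** M ** P"

lemma metric_prod_eq_inner: "metric_prod h U V = U \<bullet> (h *v V)"
  by (simp add: metric_prod_def inner_vec_def matrix_vector_mult_def sum_distrib_left mult_ac)

lemma flat_eq_mult: "flat h V = h *v V"
  by (simp add: flat_def matrix_vector_mult_def)

lemma contract_eq_mult: "contract V F = transpose F *v V"
  by (simp add: contract_def matrix_vector_mult_def transpose_def mult.commute)

lemma metric_prod_pullback: "metric_prod (pullback_form P h) U V = metric_prod h (P *v U) (P *v V)"
  by (simp add: metric_prod_eq_inner pullback_form_def dot_lmul_matrix
      flip: matrix_vector_mul_assoc) (metis dot_lmul_matrix vector_transpose_matrix transpose_transpose)

lemma flat_pullback: "flat (pullback_form P h) V = transpose P *v flat h (P *v V)"
  by (simp add: flat_eq_mult pullback_form_def flip: matrix_vector_mul_assoc)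

lemma contract_pullback: "contract V (pullback_form P F) = transpose P *v contract (P *v V) F"
  by (simp add: contract_eq_mult pullback_form_def matrix_transpose_mul flip: matrix_vector_mul_assoc)

section \<open>Raised indices, Hodge dual and inner product under a change of frame\<close>

lemma matrix_inv_pullback:
  fixes P h :: "real^'n^'n"
  assumes "invertible P" "invertible h"
  shows "matrix_inv (pullback_form P h)
    = matrix_inv P ** matrix_inv h ** transpose (matrix_inv P)"
proof (rule matrix_inv_eqI)
  have "pullback_form P h ** (matrix_inv P ** matrix_inv h ** transpose (matrix_inv P))
    = transpose P ** h ** (P ** matrix_inv P) ** matrix_inv h ** transpose (matrix_inv P)"
    by (simp only: pullback_form_def matrix_mul_assoc)
  also have "\<dots> = transpose P ** (h ** matrix_inv h) ** transpose (matrix_inv P)"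
    by (simp only: matrix_inv_right[OF assms(1)] matrix_mul_rid matrix_mul_assoc)
  also have "\<dots> = mat 1"
    by (simp add: matrix_inv_right assms matrix_inv_left transpose_mat flip: matrix_transpose_mul)
  finally show "pullback_form P h ** (matrix_inv P ** matrix_inv h ** transpose (matrix_inv P)) = mat 1" .
qed

text \<open>\<open>G\<close> with both indices raised. The transpose on the right reproduces the
  index order of the sums in \<open>hodge\<close> and \<open>form_inner\<close>.\<close>

definition raise_form :: "real^'n^'n \<Rightarrow> real^'n^'n \<Rightarrow> real^'n^'n" where
  "raise_form h G = matrix_inv h ** G ** transpose (matrix_inv h)"

text \<open>Upper indices transform in the opposite direction. Solving for the raised form in the
  original coordinates makes the two factors \<open>P\<close> explicit that
  \<open>perm_symbol_contract\<close> consumes.\<close>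

lemma raise_form_pullback:
  fixes P h :: "real^'n^'n"
  assumes P: "invertible P" and h: "invertible h"
  shows "raise_form h G
    = P ** raise_form (pullback_form P h) (pullback_form P G) ** transpose P"
proof -
  have PQ: "P ** matrix_inv P = mat 1" using matrix_inv_right[OF P] .
  have PQt: "transpose (matrix_inv P) ** transpose P = mat 1"
    by (simp add: PQ transpose_mat flip: matrix_transpose_mul)
  have "P ** raise_form (pullback_form P h) (pullback_form P G) ** transpose P
    = (P ** matrix_inv P) ** matrix_inv h ** (transpose (matrix_inv P) ** transpose P) ** G
      ** (P ** matrix_inv P) ** transpose (matrix_inv h) ** (transpose (matrix_inv P) ** transpose P)"
    unfolding raise_form_def matrix_inv_pullback[OF P h]
    by (simp only: pullback_form_def matrix_transpose_mul transpose_transpose matrix_mul_assoc)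
  then show ?thesis
    by (simp add: PQ PQt raise_form_def)
qed

lemma raise_form_nth:
  "raise_form h G $ c $ d
    = (\<Sum>p\<in>UNIV. \<Sum>q\<in>UNIV. matrix_inv h $ c $ p * matrix_inv h $ d $ q * G $ p $ q)"
  by (simp add: raise_form_def matrix_matrix_mult_def transpose_def sum_distrib_right)
    (subst sum.swap, simp add: mult_ac)

lemma hodge_raise_form:
  "hodge h G = (\<chi> a b. 1 / 2 * sqrt (- det h) *
    (\<Sum>c\<in>UNIV. \<Sum>d\<in>UNIV. perm_symbol a b c d * raise_form h G $ c $ d))"
  by (simp add: hodge_def raise_form_nth sum_distrib_left mult_ac)

text \<open>As a trace, the inner product can be handled by cyclicity instead of by reordering index
  sums.\<close>

lemma form_inner_raise_form:
  "form_inner h G H = 1 / 2 * trace (transpose (raise_form h H) ** G)"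
proof -
  have "trace (transpose (raise_form h H) ** G)
    = (\<Sum>b\<in>UNIV. \<Sum>a\<in>UNIV. \<Sum>c\<in>UNIV. \<Sum>d\<in>UNIV.
        matrix_inv h $ a $ c * matrix_inv h $ b $ d * G $ a $ b * H $ c $ d)"
    by (simp add: trace_def matrix_matrix_mult_def transpose_def raise_form_nth sum_distrib_left
        sum_distrib_right mult_ac)
  also have "\<dots> = (\<Sum>a\<in>UNIV. \<Sum>b\<in>UNIV. \<Sum>c\<in>UNIV. \<Sum>d\<in>UNIV.
        matrix_inv h $ a $ c * matrix_inv h $ b $ d * G $ a $ b * H $ c $ d)"
    by (rule sum.swap)
  finally show ?thesis
    by (simp add: form_inner_def)
qed

lemma pullback_form_nth:
  "pullback_form P M $ i $ j = (\<Sum>a\<in>UNIV. \<Sum>b\<in>UNIV. P $ a $ i * P $ b $ j * M $ a $ b)"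
  by (simp add: pullback_form_def matrix_matrix_mult_def transpose_def sum_distrib_right)
    (subst sum.swap, simp add: mult_ac)

text \<open>Two factors \<open>P\<close> come from pulling back the dual and two from the raised
  form. Contracted with the symbol they give \<open>det P\<close>, which is exactly how
  \<open>sqrt (- det h)\<close> scales when \<open>det P\<close> is positive.\<close>

lemma hodge_pullback:
  assumes P: "det P > 0" and h: "invertible h"
  shows "hodge (pullback_form P h) (pullback_form P G) = pullback_form P (hodge h G)"
proof -
  let ?R = "raise_form (pullback_form P h) (pullback_form P G)"
  have invP: "invertible P"
    using P by (simp add: invertible_det_nz)
  have det: "sqrt (- det (pullback_form P h)) = sqrt (- det h) * det P"
  proof -
    have "- det (pullback_form P h) = (- det h) * (det P)\<^sup>2"
      by (simp add: pullback_form_def det_mul power2_eq_square)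
    then show ?thesis
      using P by (simp only: real_sqrt_mult real_sqrt_abs abs_of_pos)
  qed
  have R: "raise_form h G $ c $ d = (\<Sum>k\<in>UNIV. \<Sum>l\<in>UNIV. P $ c $ k * P $ d $ l * ?R $ k $ l)" for c d
    using pullback_form_nth[of "transpose P" ?R c d]
    by (simp add: raise_form_pullback[OF invP h, of G] pullback_form_def transpose_def)
  have "pullback_form P (hodge h G) $ i $ j = hodge (pullback_form P h) (pullback_form P G) $ i $ j" for i j
  proof -
    have "pullback_form P (hodge h G) $ i $ j
      = 1 / 2 * sqrt (- det h) * (\<Sum>a\<in>UNIV. \<Sum>b\<in>UNIV. \<Sum>c\<in>UNIV. \<Sum>d\<in>UNIV. \<Sum>k\<in>UNIV. \<Sum>l\<in>UNIV.
          ?R $ k $ l * (perm_symbol a b c d * (P $ a $ i * P $ b $ j * P $ c $ k * P $ d $ l)))"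
      by (simp add: pullback_form_nth hodge_raise_form R sum_distrib_left mult_ac)
    \<comment> \<open>The four indices contracted with the symbol are moved innermost, so that
      \<open>perm_symbol_contract\<close> applies for fixed \<open>k\<close> and
      \<open>l\<close>.\<close>
    also have "\<dots> = 1 / 2 * sqrt (- det h) * (\<Sum>k\<in>UNIV. \<Sum>l\<in>UNIV. \<Sum>a\<in>UNIV. \<Sum>b\<in>UNIV. \<Sum>c\<in>UNIV. \<Sum>d\<in>UNIV.
          ?R $ k $ l * (perm_symbol a b c d * (P $ a $ i * P $ b $ j * P $ c $ k * P $ d $ l)))"
      unfolding sum.cartesian_product
      by (intro arg_cong2[where f = "(*)"] refl, rule sum.reindex_bij_witness[where
          i = "\<lambda>(k, l, a, b, c, d). (a, b, c, d, k, l)" and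
          j = "\<lambda>(a, b, c, d, k, l). (k, l, a, b, c, d)"]) (auto simp: split_def)
    also have "\<dots> = 1 / 2 * sqrt (- det h) * (\<Sum>k\<in>UNIV. \<Sum>l\<in>UNIV. ?R $ k $ l * (det P * perm_symbol i j k l))"
      by (simp only: perm_symbol_contract flip: sum_distrib_left)
    also have "\<dots> = hodge (pullback_form P h) (pullback_form P G) $ i $ j"
      unfolding hodge_raise_form det by (simp add: sum_distrib_left mult_ac)
    finally show ?thesis .
  qed
  then show ?thesis
    by (simp add: vec_eq_iff)
qed

lemma form_inner_pullback:
  fixes P h :: "real^4^4"
  assumes P: "invertible P" and h: "invertible h"
  shows "form_inner (pullback_form P h) (pullback_form P G) (pullback_form P H) = form_inner h G H"
proof -
  let ?R = "raise_form (pullback_form P h) (pullback_form P H)"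
  \<comment> \<open>Cyclicity moves the last \<open>P\<close> to the front. The right-hand side is
    the trace obtained by inserting \<open>raise_form_pullback\<close> into the inner product for
    \<open>h\<close>.\<close>
  have "trace (transpose ?R ** (transpose P ** G ** P))
    = trace (P ** (transpose ?R ** transpose P ** G))"
    by (subst (2) trace_mul_sym) (simp add: matrix_mul_assoc)
  then show ?thesis
    by (simp add: form_inner_raise_form raise_form_pullback[OF P h, of H] pullback_form_def
        matrix_transpose_mul matrix_mul_assoc)
qed


lemma pullback_form_linear:
  "pullback_form P (c *\<^sub>R (A + d *\<^sub>R B)) = c *\<^sub>R (pullback_form P A + d *\<^sub>R pullback_form P B)"
  by (simp add: vec_eq_iff pullback_form_nth sum_distrib_left distrib_left sum.distrib mult_ac)

text \<open>The scalars \<open>psi\<close> and \<open>kappa\<close> do not depend on the frame, and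
  in the square of \<open>F\<close> the frame matrices cancel against those of the inverse
  metric.\<close>

lemma tilde_metric_pullback:
  fixes P h :: "real^4^4"
  assumes P: "det P > 0" and h: "invertible h"
  shows "tilde_metric (pullback_form P h) (pullback_form P F) = pullback_form P (tilde_metric h F)"
proof -
  have invP: "invertible P"
    using P by (simp add: invertible_det_nz)
  have PQ: "P ** matrix_inv P = mat 1" using matrix_inv_right[OF invP] .
  have PQt: "transpose (matrix_inv P) ** transpose P = mat 1"
    by (simp add: PQ flip: matrix_transpose_mul)
  have "form_square (pullback_form P h) (pullback_form P F)
    = transpose P ** F ** (P ** matrix_inv P) ** matrix_inv h
      ** (transpose (matrix_inv P) ** transpose P) ** F ** P"
    unfolding form_square_def matrix_inv_pullback[OF invP h]
    by (simp only: pullback_form_def matrix_mul_assoc)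
  also have "\<dots> = pullback_form P (form_square h F)"
    unfolding PQ PQt matrix_mul_rid by (simp only: form_square_def pullback_form_def matrix_mul_assoc)
  finally have square: "form_square (pullback_form P h) (pullback_form P F)
    = pullback_form P (form_square h F)" .
  have "kappa (pullback_form P h) (pullback_form P F) = kappa h F"
    "psi (pullback_form P h) (pullback_form P F) = psi h F"
    by (simp_all add: kappa_def psi_def phi_def hodge_pullback[OF P h] form_inner_pullback[OF invP h])
  then show ?thesis
    by (simp only: tilde_metric_def square pullback_form_linear)
qed

subsection \<open>Orthonormal frames\<close>

definition diag_form :: "(4 \<Rightarrow> real) \<Rightarrow> real^4^4" where
  "diag_form s = (\<chi> i j. if i = j then s i else 0)"

lemma diag_form_nth: "diag_form s $ i $ j = (if i = j then s i else 0)"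
  by (simp add: diag_form_def)

lemma det_diag_form: "det (diag_form s) = s 0 * s 1 * s 2 * s 3"
proof -
  have "det (diag_form s) = (\<Prod>i\<in>UNIV. diag_form s $ i $ i)"
    by (rule det_diagonal) (simp add: diag_form_nth)
  then show ?thesis
    unfolding UNIV_4_zero by (simp add: diag_form_nth)
qed

lemma minkowski_eq_diag_form: "minkowski = diag_form (quad 1 (-1) (-1) (-1))"
  unfolding vec_eq_iff forall_4_zero by (simp add: minkowski_def diag_form_nth)

lemma matrix_inv_diag_form:
  assumes "\<And>i. s i * s i = 1"
  shows "matrix_inv (diag_form s) = diag_form s"
  by (rule matrix_inv_eqI) (simp add: vec_eq_iff matrix_matrix_mult_def diag_form_nth mat_def assms
      if_distrib[of "\<lambda>x. x * _"] cong: if_cong)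

lemma raise_form_diag_form:
  assumes "\<And>i. s i * s i = 1"
  shows "raise_form (diag_form s) G $ c $ d = s c * s d * G $ c $ d"
proof -
  have "raise_form (diag_form s) G $ c $ d = (\<Sum>p\<in>UNIV. \<Sum>q\<in>UNIV.
      if p = c then if q = d then s c * s d * G $ p $ q else 0 else 0)"
    unfolding raise_form_nth matrix_inv_diag_form[OF assms]
    by (intro sum.cong refl) (auto simp: diag_form_nth)
  also have "\<dots> = (\<Sum>p\<in>UNIV. if p = c then \<Sum>q\<in>UNIV.
      if q = d then s c * s d * G $ p $ q else 0 else 0)"
    by (intro sum.cong refl) simp
  finally show ?thesis
    by simp
qed

section \<open>Timelike and spacelike vectors of a Lorentzian form\<close>

lemma metric_prod_commute:
  assumes "transpose h = h"
  shows "metric_prod h U V = metric_prod h V U"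
proof -
  have "U \<bullet> (h *v V) = (U v* h) \<bullet> V"
    by (simp add: dot_lmul_matrix)
  also have "\<dots> = (transpose h *v U) \<bullet> V"
    by simp
  finally show ?thesis
    by (simp add: assms metric_prod_eq_inner inner_commute)
qed

lemma metric_prod_axis: "metric_prod h (axis i 1) (axis j 1) = h $ i $ j"
  by (simp add: metric_prod_eq_inner inner_axis' matrix_vector_mult_basis column_def)

lemma metric_prod_minkowski:
  "metric_prod minkowski x y = x $ 0 * y $ 0 - x $ 1 * y $ 1 - x $ 2 * y $ 2 - x $ 3 * y $ 3"
  by (simp add: metric_prod_def sum_4_zero minkowski_def)

lemma invertible_lorentzian_form:
  assumes "lorentzian_form h"
  shows "invertible h"
proof -
  obtain P where "transpose P ** h ** P = minkowski"
    using assms by (auto simp: lorentzian_form_def)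
  then have "det (transpose P ** h ** P) = det minkowski"
    by simp
  then have "det P * det h * det P = - 1"
    by (simp add: det_mul minkowski_eq_diag_form det_diag_form)
  then show ?thesis
    by (auto simp: invertible_det_nz)
qed

text \<open>Let \<open>X\<close> and \<open>V\<close> be the squared lengths of the spatial parts.
  If \<open>v\<close> were not spacelike, Cauchy-Schwarz for the spatial parts would give
  \<open>(x $ 0 * v $ 0)^2 \<le> X * V \<le> X * (v $ 0)^2\<close>. As \<open>X < (x $ 0)^2\<close>,
  this forces \<open>v $ 0 = 0\<close>, hence \<open>V = 0\<close> and \<open>v = 0\<close>.\<close>

lemma minkowski_spacelike_complement:
  assumes xx: "metric_prod minkowski x x > 0" and xv: "metric_prod minkowski x v = 0" and v: "v \<noteq> 0"
  shows "metric_prod minkowski v v < 0"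
proof (rule ccontr)
  define X where "X = (x $ 1)\<^sup>2 + (x $ 2)\<^sup>2 + (x $ 3)\<^sup>2"
  define V where "V = (v $ 1)\<^sup>2 + (v $ 2)\<^sup>2 + (v $ 3)\<^sup>2"
  assume "\<not> metric_prod minkowski v v < 0"
  then have V: "V \<le> (v $ 0)\<^sup>2" and X: "X < (x $ 0)\<^sup>2"
    using xx by (simp_all add: metric_prod_minkowski V_def X_def power2_eq_square)
  have pos: "V \<ge> 0" "X \<ge> 0"
    by (simp_all add: V_def X_def)
  have dot: "x $ 0 * v $ 0 = x $ 1 * v $ 1 + x $ 2 * v $ 2 + x $ 3 * v $ 3"
    using xv by (simp add: metric_prod_minkowski)
  \<comment> \<open>Lagrange's identity\<close>
  have "X * V - (x $ 0 * v $ 0)\<^sup>2 = (x $ 1 * v $ 2 - x $ 2 * v $ 1)\<^sup>2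
      + (x $ 1 * v $ 3 - x $ 3 * v $ 1)\<^sup>2 + (x $ 2 * v $ 3 - x $ 3 * v $ 2)\<^sup>2"
    unfolding dot X_def V_def by (simp add: power2_eq_square algebra_simps)
  then have "(x $ 0)\<^sup>2 * (v $ 0)\<^sup>2 \<le> X * V"
    using zero_le_power2[of "x $ 1 * v $ 2 - x $ 2 * v $ 1"]
      zero_le_power2[of "x $ 1 * v $ 3 - x $ 3 * v $ 1"]
      zero_le_power2[of "x $ 2 * v $ 3 - x $ 3 * v $ 2"]
    unfolding power_mult_distrib by linarith
  also have "\<dots> \<le> X * (v $ 0)\<^sup>2"
    using V pos by (simp add: mult_left_mono)
  finally have "((x $ 0)\<^sup>2 - X) * (v $ 0)\<^sup>2 \<le> 0"
    by (simp add: algebra_simps)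
  then have "v $ 0 = 0"
    using X by (simp add: mult_le_0_iff)
  with V have "V \<le> 0" by simp
  then have "(v $ 1)\<^sup>2 = 0" "(v $ 2)\<^sup>2 = 0" "(v $ 3)\<^sup>2 = 0"
    unfolding V_def using zero_le_power2[of "v $ 1"] zero_le_power2[of "v $ 2"] zero_le_power2[of "v $ 3"]
    by linarith+
  with \<open>v $ 0 = 0\<close> v show False
    by (simp add: vec_eq_iff forall_4_zero)
qed

lemma lorentzian_spacelike_complement:
  assumes h: "lorentzian_form h" and xx: "metric_prod h x x > 0" and xv: "metric_prod h x v = 0"
    and v: "v \<noteq> 0"
  shows "metric_prod h v v < 0"
proof -
  obtain P where P: "invertible P" "pullback_form P h = minkowski"
    using h by (auto simp: lorentzian_form_def pullback_form_def)
  have inv: "P *v (matrix_inv P *v y) = y" for y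
    by (simp add: matrix_vector_mul_assoc matrix_inv_right P)
  have eq: "metric_prod h y z = metric_prod minkowski (matrix_inv P *v y) (matrix_inv P *v z)" for y z
    by (simp add: inv metric_prod_pullback flip: P(2))
  have "matrix_inv P *v v \<noteq> 0"
    using inv[of v] v by auto
  then show ?thesis
    using minkowski_spacelike_complement xx xv unfolding eq by blast
qed

text \<open>Three linear conditions in dimension four leave a nonzero solution. Orthogonality to the
  timelike \<open>x\<close> makes it spacelike, so it can be normalized.\<close>

lemma lorentzian_unit_complement:
  assumes h: "lorentzian_form h" and x: "metric_prod h x x = 1"
  obtains e where "metric_prod h e e = - 1" "metric_prod h x e = 0" "metric_prod h y e = 0"
    "metric_prod h z e = 0"
proof -
  have sym: "transpose h = h"
    using h by (simp add: lorentzian_form_def)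
  \<comment> \<open>Euclidean orthogonality to \<open>h *v u\<close> is
    \<open>h\<close>-orthogonality to \<open>u\<close>, which brings the theorem on Euclidean
    complements into play.\<close>
  let ?S = "{h *v x, h *v y, h *v z}"
  have "dim ?S \<le> card ?S"
    by (rule dim_le_card') simp
  also have "card ?S < DIM(real^4)"
    using card_insert_le_m1[of 3 "{h *v y, h *v z}" "h *v x"] card_insert_le_m1[of 2 "{h *v z}" "h *v y"]
    by simp
  finally obtain v where v: "v \<noteq> 0" and orth: "\<And>u. u \<in> span ?S \<Longrightarrow> orthogonal v u"
    using orthogonal_to_subspace_exists by blast
  have "metric_prod h v u = 0" if "h *v u \<in> ?S" for u
    using orth[OF span_base[OF that]] by (simp add: metric_prod_eq_inner orthogonal_def)
  then have 0: "metric_prod h u v = 0" if "h *v u \<in> ?S" for u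
    using that metric_prod_commute[OF sym, of u v] by simp
  have neg: "metric_prod h v v < 0"
    using lorentzian_spacelike_complement[OF h _ 0 v, of x] x by simp
  let ?c = "1 / sqrt (- metric_prod h v v)"
  have scale: "metric_prod h u (?c *\<^sub>R v) = ?c * metric_prod h u v"
    "metric_prod h (?c *\<^sub>R v) u = ?c * metric_prod h v u" for u
    by (simp_all add: metric_prod_eq_inner matrix_vector_mult_scaleR)
  have "metric_prod h (?c *\<^sub>R v) (?c *\<^sub>R v) = - 1"
    unfolding scale using neg by (simp add: divide_simps)
  then show thesis
    using that[of "?c *\<^sub>R v"] 0 by (simp add: scale)
qed

text \<open>Two applications of \<open>lorentzian_unit_complement\<close> supply the remaining frame
  vectors \<open>Y\<close> and \<open>Z\<close>. If the frame is negatively oriented,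
  \<open>Z\<close> is reversed.\<close>

lemma orthonormal_frame:
  assumes h: "lorentzian_form h" and X: "metric_prod h X X = 1"
    and XW: "metric_prod h X W = 0" and W: "metric_prod h W W = - 1"
  obtains P where "det P > 0" "pullback_form P h = minkowski"
    "P *v axis 0 1 = X" "P *v axis 1 1 = W"
proof -
  have sym: "transpose h = h"
    using h by (simp add: lorentzian_form_def)
  obtain Y where Y: "metric_prod h Y Y = - 1" "metric_prod h X Y = 0" "metric_prod h W Y = 0"
    using lorentzian_unit_complement[OF h X] by metis
  obtain Z where Z: "metric_prod h Z Z = - 1" "metric_prod h X Z = 0" "metric_prod h W Z = 0"
    "metric_prod h Y Z = 0"
    using lorentzian_unit_complement[OF h X] by metis
  define P :: "real^4^4" where "P = (\<chi> a i. quad X W Y Z i $ a)"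
  \<comment> \<open>Changes the sign of the last frame vector only: this reverses the orientation
    but keeps \<open>X\<close> and \<open>W\<close>.\<close>
  define D where "D = diag_form (quad 1 1 1 (-1))"
  have P_axis: "P *v axis i 1 = quad X W Y Z i" for i
    by (simp add: matrix_vector_mult_basis column_def P_def)
  have P_nth: "pullback_form P h $ i $ j = metric_prod h (quad X W Y Z i) (quad X W Y Z j)" for i j
    by (simp only: metric_prod_pullback P_axis flip: metric_prod_axis)
  note sym' = metric_prod_commute[OF sym]
  have P: "pullback_form P h = minkowski"
    unfolding vec_eq_iff forall_4_zero
    by (simp add: P_nth X XW W Y Z minkowski_def sym'[of W X] sym'[of Y X] sym'[of Z X]
        sym'[of Y W] sym'[of Z W] sym'[of Z Y])
  have "det P * det h * det P = - 1"
    using arg_cong[OF P, of det]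
    by (simp add: pullback_form_def det_mul minkowski_eq_diag_form det_diag_form)
  then have "det P \<noteq> 0" by auto
  then consider "det P > 0" | "det P < 0" by linarith
  then show thesis
  proof cases
    case 1
    then show thesis
      using that[OF _ P] by (simp add: P_axis)
  next
    case 2
    have det_D: "det D = - 1"
      by (simp add: D_def det_diag_form)
    have D_axis: "D *v axis i 1 = axis i 1" if "i \<noteq> 3" for i
      unfolding matrix_vector_mult_basis using that forall_4_zero[of "\<lambda>i. i \<noteq> 3 \<longrightarrow> quad 1 1 1 (-1) i = (1::real)"]
      by (simp add: column_def D_def diag_form_nth vec_eq_iff axis_def)
    have "pullback_form (P ** D) h = pullback_form D minkowski"
      by (simp add: pullback_form_def matrix_transpose_mul matrix_mul_assoc flip: P)
    also have "\<dots> = minkowski"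
      unfolding vec_eq_iff forall_4_zero
      by (simp add: pullback_form_nth sum_4_zero D_def diag_form_nth minkowski_def)
    finally show thesis
      using that[of "P ** D"] 2
      by (simp add: det_mul det_D D_axis P_axis flip: matrix_vector_mul_assoc)
  qed
qed

subsection \<open>The two-form in the frame of a wrench observer\<close>

text \<open>The normal form of the 2-form in the frame of a wrench observer. The sign of
  \<open>\<beta>\<close> arises because the dual has 01-component \<open>F_23\<close>, while
  lowering the index of \<open>\<beta> W\<close> gives \<open>- \<beta>\<close>.\<close>

definition faraday :: "real \<Rightarrow> real \<Rightarrow> real^4^4" where
  "faraday \<alpha> \<beta> = (\<chi> i j. if i = 0 \<and> j = 1 then \<alpha> else if i = 1 \<and> j = 0 then - \<alpha>
     else if i = 2 \<and> j = 3 then - \<beta> else if i = 3 \<and> j = 2 then \<beta> else 0)"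

lemma perm_symbol_repeated: "\<not> distinct [a, b, c, d] \<Longrightarrow> perm_symbol a b c d = 0"
  by (simp only: perm_symbol_def if_False)

text \<open>Chains of adjacent swaps lead back to \<open>[0123]\<close>. Tuples beginning with 0
  serve to read off the row of the dual seen by the observer; those beginning with 10, 23 or 32
  occur in the duals of \<open>faraday\<close>.\<close>

lemma perm_symbol_even:
  "perm_symbol 0 2 3 1 = 1" "perm_symbol 0 3 1 2 = 1" "perm_symbol 1 0 3 2 = 1"
  "perm_symbol 2 3 0 1 = 1" "perm_symbol 3 2 1 0 = 1"
  using perm_symbol_0123 perm_symbol_swap[of 0 1 2 3]
    perm_symbol_swap[of 0 1 3 2] perm_symbol_swap[of 0 2 1 3] perm_symbol_swap[of 0 2 3 1]
    perm_symbol_swap[of 0 3 2 1] perm_symbol_swap[of 1 0 2 3] perm_symbol_swap[of 2 0 1 3]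
    perm_symbol_swap[of 2 0 3 1] perm_symbol_swap[of 2 3 0 1] perm_symbol_swap[of 3 2 0 1]
  by linarith+

lemma perm_symbol_odd:
  "perm_symbol 0 1 3 2 = - 1" "perm_symbol 0 2 1 3 = - 1" "perm_symbol 0 3 2 1 = - 1"
  "perm_symbol 1 0 2 3 = - 1" "perm_symbol 2 3 1 0 = - 1" "perm_symbol 3 2 0 1 = - 1"
  using perm_symbol_0123 perm_symbol_even perm_symbol_swap[of 0 1 2 3] perm_symbol_swap[of 0 3 1 2]
    perm_symbol_swap[of 2 3 0 1]
  by simp_all

lemmas perm_symbol_eval = perm_symbol_0123 perm_symbol_even perm_symbol_odd perm_symbol_repeated

text \<open>The volume factor is 1 and raising indices only inserts signs. General signs are allowed
  because both metrics take this shape in the adapted frame.\<close>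

lemma hodge_diag_form:
  assumes "\<And>i. s i * s i = 1" and "s 0 * s 1 * s 2 * s 3 = - 1"
  shows "hodge (diag_form s) G $ a $ b
    = 1 / 2 * (\<Sum>c\<in>UNIV. \<Sum>d\<in>UNIV. perm_symbol a b c d * (s c * s d * G $ c $ d))"
  using assms by (simp add: hodge_raise_form raise_form_diag_form det_diag_form)

lemma quad_sign_square: "quad 1 (-1) (-1) (-1) i * quad 1 (-1) (-1) (-1) i = (1::real)"
  "quad (-1) 1 (-1) (-1) i * quad (-1) 1 (-1) (-1) i = (1::real)"
  by (simp_all add: quad_def)

lemma hodge_minkowski: "hodge minkowski G $ a $ b
    = 1 / 2 * (\<Sum>c\<in>UNIV. \<Sum>d\<in>UNIV. perm_symbol a b c d *
        (quad 1 (-1) (-1) (-1) c * quad 1 (-1) (-1) (-1) d * G $ c $ d))"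
  unfolding minkowski_eq_diag_form by (rule hodge_diag_form) (simp_all add: quad_sign_square)

lemma form_inner_minkowski: "form_inner minkowski G H
    = 1 / 2 * (\<Sum>a\<in>UNIV. \<Sum>b\<in>UNIV.
        quad 1 (-1) (-1) (-1) a * quad 1 (-1) (-1) (-1) b * H $ a $ b * G $ a $ b)"
  unfolding minkowski_eq_diag_form form_inner_raise_form trace_def matrix_matrix_mult_def
  by (simp add: transpose_def raise_form_diag_form quad_sign_square) (rule sum.swap)

text \<open>The electric equation fixes the components \<open>G_0i\<close>. The magnetic one fixes
  row 0 of the dual, that is \<open>G_23\<close>, \<open>G_31\<close> and \<open>G_12\<close>.
  Antisymmetry supplies the rest.\<close>

lemma faraday_of_wrench:
  assumes anti: "transpose G = - G"
    and E: "flat minkowski (\<alpha> *\<^sub>R axis 1 1) = - contract (axis 0 1) G"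
    and B: "flat minkowski (\<beta> *\<^sub>R axis 1 1) = contract (axis 0 1) (hodge minkowski G)"
  shows "G = faraday \<alpha> \<beta>"
proof -
  have anti': "G $ j $ i = - G $ i $ j" for i j
    using arg_cong[OF anti, of "\<lambda>M. M $ i $ j"] by (simp add: transpose_def)
  have diag: "G $ i $ i = 0" for i
    using anti'[of i i] by simp
  have row: "contract (axis 0 1) M $ i = M $ 0 $ i" for M i
    by (simp add: contract_def sum_4_zero axis_def)
  have col: "flat minkowski (c *\<^sub>R axis 1 1) $ i = (if i = 1 then - c else 0)" for c i
    using forall_4_zero[of "\<lambda>i. flat minkowski (c *\<^sub>R axis 1 1) $ i = (if i = 1 then - c else 0)"]
    by (simp add: flat_def sum_4_zero axis_def minkowski_def)
  have "G $ 0 $ i = (if i = 1 then \<alpha> else 0)" for i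
    using arg_cong[OF E, of "\<lambda>v. v $ i"] unfolding col by (simp add: row split: if_splits)
  moreover have dual: "hodge minkowski G $ 0 $ i = (if i = 1 then - \<beta> else 0)" for i
    using arg_cong[OF B, of "\<lambda>v. v $ i"] unfolding col row by simp
  have "G $ 2 $ 3 = - \<beta>" "G $ 3 $ 1 = 0" "G $ 1 $ 2 = 0"
    using dual[of 1] dual[of 2] dual[of 3] anti'[of 2 3] anti'[of 3 1] anti'[of 1 2]
    by (simp_all add: hodge_minkowski sum_4_zero perm_symbol_eval)
  ultimately show ?thesis
    using anti'[of 0 1] anti'[of 0 2] anti'[of 0 3] anti'[of 2 3] anti'[of 3 1] anti'[of 1 2]
    unfolding vec_eq_iff forall_4_zero by (simp add: faraday_def diag)
qed

section \<open>Invariants and second metric of the normal form\<close>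

lemma psi_faraday: "psi minkowski (faraday \<alpha> \<beta>) = \<beta>\<^sup>2 - \<alpha>\<^sup>2"
  by (simp add: psi_def form_inner_minkowski sum_4_zero faraday_def power2_eq_square field_simps)

lemma phi_faraday: "phi minkowski (faraday \<alpha> \<beta>) = 2 * \<alpha> * \<beta>"
  by (simp add: phi_def form_inner_minkowski hodge_minkowski sum_4_zero faraday_def perm_symbol_eval)

text \<open>\<open>psi + i phi\<close> is the square of the complex number
  \<open>\<beta> + i \<alpha>\<close>, and \<open>kappa\<close> is half its modulus.\<close>

lemma kappa_faraday: "kappa minkowski (faraday \<alpha> \<beta>) = (\<alpha>\<^sup>2 + \<beta>\<^sup>2) / 2"
proof -
  have "(\<beta>\<^sup>2 - \<alpha>\<^sup>2)\<^sup>2 + (2 * \<alpha> * \<beta>)\<^sup>2 = (\<alpha>\<^sup>2 + \<beta>\<^sup>2)\<^sup>2"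
    by (simp add: power2_eq_square algebra_simps)
  then show ?thesis
    by (simp add: kappa_def psi_faraday phi_faraday)
qed

text \<open>The \<open>psi\<close> term removes the trace of the diagonal square of
  \<open>F\<close>. The remaining entries all equal \<open>kappa\<close> up to sign, and regularity
  permits division by it.\<close>

lemma tilde_metric_faraday:
  assumes "regular_form minkowski (faraday \<alpha> \<beta>)"
  shows "tilde_metric minkowski (faraday \<alpha> \<beta>) = diag_form (quad (-1) 1 (-1) (-1))"
proof -
  have nz: "\<alpha>\<^sup>2 + \<beta>\<^sup>2 \<noteq> 0"
    using assms by (simp add: regular_form_def kappa_faraday)
  have square: "form_square minkowski (faraday \<alpha> \<beta>)
      = diag_form (quad (\<alpha>\<^sup>2) (- \<alpha>\<^sup>2) (\<beta>\<^sup>2) (\<beta>\<^sup>2))"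
    unfolding form_square_def minkowski_eq_diag_form matrix_inv_diag_form[OF quad_sign_square(1)]
      vec_eq_iff forall_4_zero
    by (simp add: matrix_matrix_mult_def sum_4_zero diag_form_nth faraday_def power2_eq_square)
  have "form_square minkowski (faraday \<alpha> \<beta>) + ((\<beta>\<^sup>2 - \<alpha>\<^sup>2) / 2) *\<^sub>R minkowski
      = - ((\<alpha>\<^sup>2 + \<beta>\<^sup>2) / 2) *\<^sub>R diag_form (quad (-1) 1 (-1) (-1))"
    unfolding square unfolding minkowski_eq_diag_form vec_eq_iff forall_4_zero
    by (simp add: diag_form_nth field_simps)
  moreover have "- inverse ((\<alpha>\<^sup>2 + \<beta>\<^sup>2) / 2) * - ((\<alpha>\<^sup>2 + \<beta>\<^sup>2) / 2) = 1"
  proof -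
    have "- inverse x * - x = 1" if "x \<noteq> 0" for x :: real
      using that by simp
    then show ?thesis
      using nz by (metis divide_eq_0_iff zero_neq_numeral)
  qed
  ultimately show ?thesis
    by (simp only: tilde_metric_def kappa_faraday psi_faraday scaleR_scaleR scaleR_one)
qed

text \<open>In row 1 of the dual only the 10-component survives. It is
  \<open>F_32 = \<beta>\<close>, since the signs of the second metric at 2 and 3 multiply to
  1.\<close>

lemma hodge_tilde_faraday:
  "contract (axis 1 1) (hodge (diag_form (quad (-1) 1 (-1) (-1))) (faraday \<alpha> \<beta>)) = \<beta> *\<^sub>R axis 0 1"
  unfolding vec_eq_iff forall_4_zero
  by (simp add: contract_def sum_4_zero axis_def hodge_diag_form quad_sign_square faraday_def perm_symbol_eval)

subsection \<open>Electric and magnetic vectors\<close>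

lemma flat_inject:
  assumes "invertible h"
  shows "flat h U = flat h V \<longleftrightarrow> U = V"
  using inj_matrix_vector_mult[OF assms] by (simp add: flat_eq_mult inj_eq)

lemma the_flat_eqI:
  assumes "invertible h" "flat h V = w"
  shows "(THE E. flat h E = w) = V"
  using assms flat_inject by blast

text \<open>Turns a value of \<open>electric\<close> or \<open>magnetic\<close> back into its
  defining equation; the inverse matrix provides existence.\<close>

lemma flat_the:
  assumes "invertible h"
  shows "flat h (THE E. flat h E = w) = w"
proof -
  have "flat h (matrix_inv h *v w) = w"
    by (simp add: flat_eq_mult matrix_vector_mul_assoc matrix_inv_right assms)
  then show ?thesis
    using the_flat_eqI[OF assms] by metis
qed

lemma matrix_vector_mult_minus: "A *v (- v) = - (A *v v)" for A :: "real^'n^'m"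
  by (simp add: vec_eq_iff matrix_vector_mult_def sum_negf)

lemma vector_matrix_mult_scale:
  fixes A :: "real^'n^'m"
  shows "(- v) v* A = - (v v* A)" and "(c *\<^sub>R v) v* A = c *\<^sub>R (v v* A)"
  by (simp_all add: vec_eq_iff vector_matrix_mult_def sum_negf sum_distrib_left mult_ac)

lemma metric_prod_scaleR:
  "metric_prod h (c *\<^sub>R U) V = c * metric_prod h U V"
  "metric_prod h U (c *\<^sub>R V) = c * metric_prod h U V"
  by (simp_all add: metric_prod_eq_inner matrix_vector_mult_scaleR)

lemma metric_prod_minus:
  "metric_prod h (- U) V = - metric_prod h U V"
  "metric_prod h U (- V) = - metric_prod h U V"
  using metric_prod_scaleR(1)[of h "-1" U V] metric_prod_scaleR(2)[of h U "-1" V] by simp_all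

text \<open>The duality in one tangent space. In the frame \<open>P\<close> both metrics are
  diagonal and \<open>F\<close> is \<open>faraday\<close>, so each claim is a computation with basis
  vectors, carried back by the naturality lemmas.\<close>

lemma wrench_duality:
  fixes g F :: "real^4^4"
  assumes g: "lorentzian_form g" and anti: "transpose F = - F" and reg: "regular_form g F"
    and X: "metric_prod g X X = 1" and XW: "metric_prod g X W = 0" and W: "metric_prod g W W = - 1"
    and E: "electric g F X = \<alpha> *\<^sub>R W" and B: "magnetic g F X = \<beta> *\<^sub>R W"
  defines "k \<equiv> tilde_metric g F"
  shows "lorentzian_form k"
    and "metric_prod k W W = 1" "metric_prod k W X = 0" "metric_prod k X X = - 1"
    and "flat k (- \<alpha> *\<^sub>R X) = \<alpha> *\<^sub>R flat g X" "flat k (- \<beta> *\<^sub>R X) = \<beta> *\<^sub>R flat g X"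
    and "electric k F W = - \<alpha> *\<^sub>R X" "magnetic k F W = - \<beta> *\<^sub>R X"
proof -
  obtain P where detP: "det P > 0" and P: "pullback_form P g = minkowski"
    and P0: "P *v axis 0 1 = X" and P1: "P *v axis 1 1 = W"
    using orthonormal_frame[OF g X XW W] .
  have invg: "invertible g"
    using g by (rule invertible_lorentzian_form)
  have invP: "invertible P"
    using detP by (simp add: invertible_det_nz)
  let ?G = "pullback_form P F"
  let ?k = "diag_form (quad (-1) 1 (-1) (-1))"
  have "transpose ?G = - ?G"
    using arg_cong[OF anti, of "pullback_form P"]
    by (simp add: vec_eq_iff transpose_def pullback_form_nth sum_negf)
      (subst sum.swap, simp add: mult_ac)
  \<comment> \<open>The defining equations of the electric and magnetic vectors are read in the
    frame, where \<open>X\<close> and \<open>W\<close> are the basis vectors 0 and 1.\<close>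
  moreover have "flat minkowski (\<alpha> *\<^sub>R axis 1 1) = - contract (axis 0 1) ?G"
    using flat_the[OF invg, of "- contract X F"] E
    by (simp add: flat_pullback contract_pullback P0 P1 electric_def matrix_vector_mult_scaleR
        vector_matrix_mult_scale flip: P)
  moreover have "flat minkowski (\<beta> *\<^sub>R axis 1 1) = contract (axis 0 1) (hodge minkowski ?G)"
    using flat_the[OF invg, of "contract X (hodge g F)"] B
    by (simp add: flat_pullback contract_pullback hodge_pullback[OF detP invg] P0 P1 magnetic_def
        matrix_vector_mult_scaleR flip: P)
  ultimately have G: "?G = faraday \<alpha> \<beta>"
    by (rule faraday_of_wrench)
  have "regular_form minkowski ?G"
    using reg by (simp add: regular_form_def kappa_def psi_def phi_def hodge_pullback[OF detP invg]
        form_inner_pullback[OF invP invg] flip: P)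
  then have Pk: "pullback_form P k = ?k"
    using tilde_metric_faraday tilde_metric_pullback[OF detP invg, of F] by (simp add: k_def P G)
  have symk: "transpose k = k"
  proof -
    have "P ** matrix_inv P = mat 1" "transpose (matrix_inv P) ** transpose P = mat 1"
      by (simp_all add: matrix_inv_right[OF invP] flip: matrix_transpose_mul)
    \<comment> \<open>Symmetry is visible only for the diagonal matrix, so \<open>k\<close> is
      written as its pullback along the inverse frame.\<close>
    then have "k = (transpose (matrix_inv P) ** transpose P) ** k ** (P ** matrix_inv P)"
      by simp
    also have "\<dots> = pullback_form (matrix_inv P) ?k"
      unfolding Pk[symmetric] by (simp only: pullback_form_def matrix_mul_assoc)
    finally have *: "k = pullback_form (matrix_inv P) ?k" .
    have "transpose ?k = ?k"
      by (auto simp: vec_eq_iff transpose_def diag_form_nth)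
    then show ?thesis
      unfolding * by (simp add: pullback_form_def matrix_transpose_mul matrix_mul_assoc)
  qed
  \<comment> \<open>Swapping \<open>X\<close> and \<open>W\<close> turns the frame into an orthonormal one for \<open>k\<close>.\<close>
  define S :: "real^4^4" where "S = (\<chi> i j. axis (quad 1 0 2 3 i) 1 $ j)"
  have S: "pullback_form S ?k = minkowski"
    unfolding vec_eq_iff forall_4_zero
    by (simp add: pullback_form_nth sum_4_zero S_def axis_def diag_form_nth minkowski_def)
  have "S ** S = mat 1"
    unfolding vec_eq_iff forall_4_zero
    by (simp add: matrix_matrix_mult_def sum_4_zero S_def axis_def mat_def)
  then have "invertible (P ** S)"
    using invP invertible_mult unfolding invertible_def by blast
  moreover have "pullback_form (P ** S) k = minkowski"
    unfolding S[symmetric] Pk[symmetric]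
    by (simp only: pullback_form_def matrix_transpose_mul matrix_mul_assoc)
  ultimately show k: "lorentzian_form k"
    using symk unfolding lorentzian_form_def pullback_form_def by blast
  have invk: "invertible k"
    using k by (rule invertible_lorentzian_form)
  show "metric_prod k W W = 1" "metric_prod k W X = 0" "metric_prod k X X = - 1"
    by (simp_all add: metric_prod_axis diag_form_nth Pk flip: P0 P1 metric_prod_pullback)
  \<comment> \<open>Equations between covectors may be checked on the frame vectors, since
    \<open>transpose P\<close> is injective.\<close>
  have cancel: "V = V'" if "transpose P *v V = transpose P *v V'" for V V' :: "real^4"
    using inj_matrix_vector_mult[OF transpose_invertible[OF invP]] that by (simp only: inj_eq)
  have kX: "flat k (c *\<^sub>R X) = - c *\<^sub>R flat g X" for c
  proof (rule cancel)
    \<comment> \<open>The two diagonal metrics have opposite entries at index 0, whence the sign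
      when \<open>X\<close> is lowered with \<open>k\<close> instead of \<open>g\<close>.\<close>
    have "flat ?k (c *\<^sub>R axis 0 1) = - c *\<^sub>R flat minkowski (axis 0 1)"
      unfolding vec_eq_iff forall_4_zero
      by (simp add: flat_def sum_4_zero axis_def diag_form_nth minkowski_def)
    then show "transpose P *v flat k (c *\<^sub>R X) = transpose P *v (- c *\<^sub>R flat g X)"
      by (simp add: flat_pullback P0 matrix_vector_mult_scaleR vector_matrix_mult_scale
          flip: P Pk)
  qed
  from this[of "- \<alpha>"] this[of "- \<beta>"]
  show "flat k (- \<alpha> *\<^sub>R X) = \<alpha> *\<^sub>R flat g X" "flat k (- \<beta> *\<^sub>R X) = \<beta> *\<^sub>R flat g X"
    by (simp_all only: minus_minus)
  show "electric k F W = - \<alpha> *\<^sub>R X"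
    unfolding electric_def
  proof (rule the_flat_eqI[OF invk cancel])
    \<comment> \<open>Both sides are \<open>\<alpha>\<close> times the basis covector 0: lowering
      contributes the sign -1, and \<open>F_10\<close> is \<open>- \<alpha>\<close>.\<close>
    have "flat ?k (- \<alpha> *\<^sub>R axis 0 1) = - contract (axis 1 1) ?G"
      unfolding G vec_eq_iff forall_4_zero
      by (simp add: flat_def contract_def sum_4_zero axis_def diag_form_nth faraday_def)
    then show "transpose P *v flat k (- \<alpha> *\<^sub>R X) = transpose P *v - contract W F"
      by (simp add: flat_pullback contract_pullback P0 P1 matrix_vector_mult_scaleR
          vector_matrix_mult_scale matrix_vector_mult_minus flip: Pk)
  qed
  show "magnetic k F W = - \<beta> *\<^sub>R X"
    unfolding magnetic_def
  proof (rule the_flat_eqI[OF invk cancel])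
    have "flat ?k (- \<beta> *\<^sub>R axis 0 1) = contract (axis 1 1) (hodge ?k ?G)"
      unfolding G hodge_tilde_faraday vec_eq_iff forall_4_zero
      by (simp add: flat_def sum_4_zero axis_def diag_form_nth)
    then show "transpose P *v flat k (- \<beta> *\<^sub>R X) = transpose P *v contract W (hodge k F)"
      by (simp add: flat_pullback contract_pullback hodge_pullback[OF detP invk] P0 P1
          matrix_vector_mult_scaleR matrix_vector_mult_minus flip: Pk)
  qed
qed

section \<open>From one tangent space to fields on the manifold\<close>

theorem mainTheorem6:
  fixes \<A> :: "('m::{t2_space, second_countable_topology}) chart set"
    and g F :: "'m chart \<Rightarrow> 'm \<Rightarrow> real^4^4"
    and T X W :: "'m chart \<Rightarrow> 'm \<Rightarrow> real^4"
    and \<alpha> \<beta> :: "'m \<Rightarrow> real"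
  assumes "oriented_atlas \<A>"
    and "lorentzian_metric \<A> g"
    and "time_orientation \<A> g T"
    and "smooth_2form \<A> F"
    and "\<forall>c\<in>\<A>. \<forall>p\<in>dom_chart c. regular_form (g c p) (F c p)"
    and "vector_field \<A> X" and "smooth_field \<A> X"
    and "vector_field \<A> W"
    and "\<forall>c\<in>\<A>. \<forall>p\<in>dom_chart c. wrench_observer (g c p) (T c p) (F c p) (X c p) (W c p)"
    and "\<forall>c\<in>\<A>. \<forall>p\<in>dom_chart c. electric (g c p) (F c p) (X c p) = \<alpha> p *\<^sub>R W c p"
    and "\<forall>c\<in>\<A>. \<forall>p\<in>dom_chart c. magnetic (g c p) (F c p) (X c p) = \<beta> p *\<^sub>R W c p"
  shows "\<forall>c\<in>\<A>. \<forall>p\<in>dom_chart c.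
    (let h = g c p;
         k = tilde_metric (g c p) (F c p);
         E = electric h (F c p) (X c p);
         B = magnetic h (F c p) (X c p);
         E' = electric k (F c p) (W c p);
         B' = magnetic k (F c p) (W c p)
     in lorentzian_form k \<and>
        metric_prod k (W c p) (W c p) = 1 \<and>
        flat k E' = \<alpha> p *\<^sub>R flat h (X c p) \<and>
        flat k B' = \<beta> p *\<^sub>R flat h (X c p) \<and>
        E' = - \<alpha> p *\<^sub>R X c p \<and>
        B' = - \<beta> p *\<^sub>R X c p \<and>
        wrench_observer k (W c p) (F c p) (W c p) (- X c p) \<and>
        metric_prod k E' E' = metric_prod h E E \<and> metric_prod h E E = - (\<alpha> p)\<^sup>2 \<and>
        metric_prod k B' B' = metric_prod h B B \<and> metric_prod h B B = - (\<beta> p)\<^sup>2 \<and>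
        metric_prod k E' B' = metric_prod h E B \<and> metric_prod h E B = - (\<alpha> p * \<beta> p))"
proof (intro ballI)
  fix c p
  assume c: "c \<in> \<A>" and p: "p \<in> dom_chart c"
  let ?g = "g c p" and ?F = "F c p" and ?X = "X c p" and ?W = "W c p"
  have g: "lorentzian_form ?g" and F: "transpose ?F = - ?F" and reg: "regular_form ?g ?F"
    and wrench: "wrench_observer ?g (T c p) ?F ?X ?W"
    and E: "electric ?g ?F ?X = \<alpha> p *\<^sub>R ?W" and B: "magnetic ?g ?F ?X = \<beta> p *\<^sub>R ?W"
    using assms c p by (auto simp: lorentzian_metric_def smooth_2form_def)
  have X: "metric_prod ?g ?X ?X = 1" and XW: "metric_prod ?g ?X ?W = 0"
    and W: "metric_prod ?g ?W ?W = - 1"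
    using wrench by (simp_all add: wrench_observer_def observer_def)
  let ?k = "tilde_metric ?g ?F"
  note dual = wrench_duality[OF g F reg X XW W E B]
  have minus: "metric_prod ?k ?W (- ?X) = 0" "metric_prod ?k (- ?X) (- ?X) = - 1"
    using dual(3,4) by (simp_all add: metric_prod_minus)
  \<comment> \<open>The future direction is \<open>W\<close> itself, so the cone condition becomes
    \<open>k(W, W) > 0\<close>. Relative to the wrench vector \<open>- X\<close> the scalars are
    again \<open>\<alpha> p\<close> and \<open>\<beta> p\<close>.\<close>
  have "wrench_observer ?k ?W ?F ?W (- ?X)"
    unfolding wrench_observer_def observer_def dual(7,8)
    using dual(2) minus by auto
  \<comment> \<open>The quadratic identities follow by bilinearity from \<open>k(X, X) = - 1\<close>
    and \<open>g(W, W) = - 1\<close>.\<close>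
  with dual show "let h = g c p;
         k = tilde_metric (g c p) (F c p);
         E = electric h (F c p) (X c p);
         B = magnetic h (F c p) (X c p);
         E' = electric k (F c p) (W c p);
         B' = magnetic k (F c p) (W c p)
     in lorentzian_form k \<and>
        metric_prod k (W c p) (W c p) = 1 \<and>
        flat k E' = \<alpha> p *\<^sub>R flat h (X c p) \<and>
        flat k B' = \<beta> p *\<^sub>R flat h (X c p) \<and>
        E' = - \<alpha> p *\<^sub>R X c p \<and>
        B' = - \<beta> p *\<^sub>R X c p \<and>
        wrench_observer k (W c p) (F c p) (W c p) (- X c p) \<and>
        metric_prod k E' E' = metric_prod h E E \<and> metric_prod h E E = - (\<alpha> p)\<^sup>2 \<and>
        metric_prod k B' B' = metric_prod h B B \<and> metric_prod h B B = - (\<beta> p)\<^sup>2 \<and>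
        metric_prod k E' B' = metric_prod h E B \<and> metric_prod h E B = - (\<alpha> p * \<beta> p)"
    by (simp add: Let_def E B W metric_prod_scaleR metric_prod_minus power2_eq_square)
qed

end
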